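(* Let $\widehat{O}$ be the collection of all words $(b_0,b_1,\dots,b_n)$ of integers ($n\geq 0$) such that, with $V_0=\infty$ and $V_{k+1}=[b_0,b_1,\dots,b_k]$ for $k=0,1,\dots,n$, one has $V_{n+1}=0$ and $V_0,V_1,\dots,V_{n+1}$ are pairwise distinct. Then $\widehat{O}$ is an exclusion set over $\mathbb{Z}$, and $\mathrm{Ex}(\widehat{O})\subsetneq \mathrm{Ex}(O)$ for any finite exclusion set $O$ over $\mathbb{Z}$.
   Context: Continued fractions. For a sequence of integers $b_0,b_1,\dots$, the (negative) integer continued fraction $[b_0,b_1,\dots]$ is $b_0-\cfrac{1}{b_1-\cfrac{1}{b_2-\cdots}}$. Put $A_0=1$, $B_0=0$, $A_1=b_0$, $B_1=1$ and $A_{n+1}=b_nA_n-A_{n-1}$, $B_{n+1}=b_nB_n-B_{n-1}$ for $n\geq 1$. The convergents are $A_n/B_n\in\widehat{\mathbb{C}}=\mathbb{C}\cup\{\infty\}$, and the value of the finite continued fraction $[b_0,\dots,b_n]$ is $A_{n+1}/B_{n+1}$. An infinite continued fraction converges if its sequence of convergents converges in the topological space $\widehat{\mathbb{C}}$ (the Riemann sphere; convergence to $\infty$ is permitted), and otherwise it diverges. Words. A word is a nonempty finite sequence of integers $(x_1,\dots,x_n)$; a word of length one is written $x_1$. A word $x$ is a substring of $[b_0,b_1,\dots]$, or of a word $(b_0,\dots,b_m)$, if $x=(b_r,b_{r+1},\dots,b_s)$ for some $0\leq r\leq s$ (contiguous). A (possibly infinite) set of words $X$ is without redundancy if no element of $X$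 is a substring of another element of $X$. Over $\mathbb{Z}$, define $\overline{X}=X\cup(-X)\cup\{0\}$, where $-X$ is obtained by negating all entries of each word and $0$ denotes the word of length one with entry $0$. $X$ is symmetric if $X=\overline{X}$. Exclusion sets. For a symmetric set $X$, $\mathrm{Ex}(X)$ is the set of all infinite integer continued fractions $[b_0,b_1,\dots]$ for which every tail $[b_n,b_{n+1},\dots]$ contains a substring from $X$. A symmetric set $X$ without redundancy is an exclusion set over $\mathbb{Z}$ if $\mathrm{Ex}(X)$ contains every divergent integer continued fraction. An exclusion set is finite if it has finite cardinality. *)

theory Defs
  imports "HOL-Analysis.Analysis" "HOL-Library.Sublist"
begin

type_synonym word = "int list"

fun cf_num :: "(nat \<Rightarrow> int) \<Rightarrow> nat \<Rightarrow> int" where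
  "cf_num b 0 = 1"
| "cf_num b (Suc 0) = b 0"
| "cf_num b (Suc (Suc n)) = b (Suc n) * cf_num b (Suc n) - cf_num b n"

fun cf_den :: "(nat \<Rightarrow> int) \<Rightarrow> nat \<Rightarrow> int" where
  "cf_den b 0 = 0"
| "cf_den b (Suc 0) = 1"
| "cf_den b (Suc (Suc n)) = b (Suc n) * cf_den b (Suc n) - cf_den b n"

(* The Riemann sphere is the one-point compactification of the complex plane;
   None is the point at infinity and Some z is the finite point z. *)
definition riemann_sphere :: "complex option topology" where
  "riemann_sphere = Alexandroff_compactification euclidean"

(* The numerator and denominator never vanish together, because
   cf_num b (Suc n) * cf_den b n - cf_num b n * cf_den b (Suc n) = -1. *)
definition cf_convergent :: "(nat \<Rightarrow> int) \<Rightarrow> nat \<Rightarrow> complex option" where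
  "cf_convergent b n =
     (if cf_den b n = 0 then None else Some (of_int (cf_num b n) / of_int (cf_den b n)))"

definition cf_converges :: "(nat \<Rightarrow> int) \<Rightarrow> bool" where
  "cf_converges b \<longleftrightarrow> (\<exists>l. limitin riemann_sphere (cf_convergent b) l sequentially)"

(* Convergent number n depends only on the entries with index below n, so the
   values of (!) w beyond the end of the word w play no role. *)
definition cf_value :: "word \<Rightarrow> complex option" where
  "cf_value w = cf_convergent ((!) w) (length w)"

definition substring_of_seq :: "word \<Rightarrow> (nat \<Rightarrow> int) \<Rightarrow> bool" where
  "substring_of_seq x b \<longleftrightarrow> (\<exists>r s. r \<le> s \<and> x = map b [r..<Suc s])"

definition without_redundancy :: "word set \<Rightarrow> bool" where
  "without_redundancy X \<longleftrightarrow> (\<forall>x\<in>X. \<forall>y\<in>X. x \<noteq> y \<longrightarrow> \<not> sublist x y)"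

definition word_closure :: "word set \<Rightarrow> word set" where
  "word_closure X = X \<union> map uminus ` X \<union> {[0]}"

definition symmetric_words :: "word set \<Rightarrow> bool" where
  "symmetric_words X \<longleftrightarrow> X = word_closure X"

definition Ex_cf :: "word set \<Rightarrow> (nat \<Rightarrow> int) set" where
  "Ex_cf X = {b. \<forall>n. \<exists>x\<in>X. substring_of_seq x (\<lambda>i. b (n + i))}"

(* Words are nonempty by convention; the type of lists does not enforce this. *)
definition exclusion_set :: "word set \<Rightarrow> bool" where
  "exclusion_set X \<longleftrightarrow>
     [] \<notin> X \<and> symmetric_words X \<and> without_redundancy X \<and>
     (\<forall>b. \<not> cf_converges b \<longrightarrow> b \<in> Ex_cf X)"

fun word_vertex :: "word \<Rightarrow> nat \<Rightarrow> complex option" where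
  "word_vertex w 0 = None"
| "word_vertex w (Suc k) = cf_value (take (Suc k) w)"

definition O_hat :: "word set" where
  "O_hat = {w. w \<noteq> [] \<and> word_vertex w (length w) = Some 0 \<and>
               inj_on (word_vertex w) {0..length w}}"

end

(*
  Write D i j = A_i B_j - A_j B_i (cf_cross below), which vanishes exactly when the convergents i and j coincide.
  A tail of b contains a word of O_hat exactly when its convergents revisit a vertex of the Farey
  graph: the word (b_r, ..., b_s) lies in O_hat iff the convergents r - 1 and s + 1 agree and
  those with index r, ..., s + 1 are distinct.

  If the convergents of a tail are distinct, the continued fraction converges: a path in the Farey
  graph can pass between the two sides of a Farey interval (p/q, r/s) only through an end point,
  so the convergents finally stay on one side.  Either this happens outside every interval
  [k, k + 1], and they tend to infinity, or they end up inside one of these, and halving it by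
  mediants confines them to arbitrarily short intervals.

  Let X be a finite exclusion set and w in O_hat.  For every c the periodic continued fraction
  with period (w, c, w, c') is divergent for a suitable c' (its convergents alternate between
  the values infinity and 0 infinitely often).  If neither c nor c' occurs in X, the word of X
  which it contains lies inside w.  Hence Ex(O_hat) is a subset of Ex(X).  For strictness take
  w = (n + 1, 1, 2, ..., 2) with n + 1 not occurring in X: then X contains a subword of
  (1, 2, ..., 2), and the continued fraction with period (1, 2, ..., 2, -2) is in Ex(X), but its
  denominators strictly increase in modulus, so no convergent is repeated.
*)
theory Submission
  imports Defs
begin

section \<open>Recurrences, shifts and cross determinants\<close>

definition cf_cross :: "(nat \<Rightarrow> int) \<Rightarrow> nat \<Rightarrow> nat \<Rightarrow> int" where
  "cf_cross b i j = cf_num b i * cf_den b j - cf_num b j * cf_den b i"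

lemma cf_cong:
  assumes "\<And>i. i < n \<Longrightarrow> b i = b' i"
  shows "cf_num b n = cf_num b' n" "cf_den b n = cf_den b' n"
proof -
  have "cf_num b n = cf_num b' n \<and> cf_den b n = cf_den b' n"
    using assms by (induction n rule: induct_nat_012) auto
  then show "cf_num b n = cf_num b' n" "cf_den b n = cf_den b' n" by auto
qed

lemma cf_uminus:
  "cf_num (\<lambda>i. - b i) n = (- 1) ^ n * cf_num b n"
  "cf_den (\<lambda>i. - b i) n = - ((- 1) ^ n * cf_den b n)"
  by (induction n rule: induct_nat_012) (auto simp: algebra_simps)

lemma cf_cross_uminus:
  "cf_cross (\<lambda>i. - b i) i j = - ((- 1) ^ (i + j) * cf_cross b i j)"
  by (simp add: cf_cross_def cf_uminus algebra_simps power_add)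

text \<open>Prepending \<open>b 0\<close> applies the map z -> b 0 - 1/z, whose matrix has rows (b
  0, -1) and (1, 0), to the convergents of the tail.\<close>

lemma cf_Suc_shift:
  "cf_num b (Suc k) = b 0 * cf_num (\<lambda>n. b (Suc n)) k - cf_den (\<lambda>n. b (Suc n)) k"
  "cf_den b (Suc k) = cf_num (\<lambda>n. b (Suc n)) k"
proof (induction k rule: induct_nat_012)
  case (ge2 n)
  { case 1 show ?case
      unfolding cf_num.simps(3)[of b "Suc n"] ge2 by (simp add: algebra_simps)
  next
    case 2 show ?case
      unfolding cf_den.simps(3)[of b "Suc n"] ge2 by simp }
qed simp_all

text \<open>As functions of \<open>i\<close>, both sides satisfy the same second-order linear
  recurrence, and they agree at \<open>i = 0\<close> and \<open>i = 1\<close>.\<close>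

lemma cf_add:
  "cf_num b (Suc r + i) = cf_num (\<lambda>n. b (Suc r + n)) i * cf_num b (Suc r)
     - cf_den (\<lambda>n. b (Suc r + n)) i * cf_num b r"
  "cf_den b (Suc r + i) = cf_num (\<lambda>n. b (Suc r + n)) i * cf_den b (Suc r)
     - cf_den (\<lambda>n. b (Suc r + n)) i * cf_den b r"
proof (induction i rule: induct_nat_012)
  case (ge2 n)
  have step: "Suc r + Suc (Suc n) = Suc (Suc (Suc r + n))" "Suc (Suc r + n) = Suc r + Suc n"
    by simp_all
  { case 1 show ?case
      unfolding step(1) cf_num.simps(3)[of b "Suc r + n"] unfolding step(2) ge2
      by (simp add: algebra_simps)
  next
    case 2 show ?case
      unfolding step(1) cf_den.simps(3)[of b "Suc r + n"] unfolding step(2) ge2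
      by (simp add: algebra_simps) }
qed simp_all

text \<open>Each entry removed from the front acts on all pairs (A, B) by one matrix of determinant
  1, and such a matrix preserves cross determinants.\<close>

lemma cf_cross_shift: "cf_cross b (r + i) (r + j) = cf_cross (\<lambda>n. b (r + n)) i j"
proof (induction r arbitrary: b)
  case (Suc r)
  have "cf_cross b (Suc (r + i)) (Suc (r + j)) = cf_cross (\<lambda>n. b (Suc n)) (r + i) (r + j)"
    by (simp add: cf_cross_def cf_Suc_shift algebra_simps)
  then show ?case
    using Suc.IH[of "\<lambda>n. b (Suc n)"] by simp
qed simp

lemma cf_cross_0_left: "cf_cross b 0 j = cf_den b j"
  by (simp add: cf_cross_def)

lemma cf_cross_Suc: "cf_cross b n (Suc n) = 1"
  using cf_cross_shift[of b n 0 1] by (simp add: cf_cross_def)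

lemma coprime_cf: "coprime (cf_num b n) (cf_den b n)"
proof (rule coprimeI)
  fix d assume "d dvd cf_num b n" "d dvd cf_den b n"
  then have "d dvd cf_cross b n (Suc n)"
    by (simp add: cf_cross_def)
  then show "is_unit d"
    by (simp add: cf_cross_Suc)
qed

text \<open>Convergents are fractions in lowest terms, so equal ones have the same denominator up to
  sign.\<close>

lemma cf_cross_eq_0_imp_abs_cf_den_eq:
  assumes "cf_cross b i j = 0"
  shows "\<bar>cf_den b i\<bar> = \<bar>cf_den b j\<bar>"
proof -
  have eq: "cf_num b i * cf_den b j = cf_num b j * cf_den b i"
    using assms by (simp add: cf_cross_def)
  have "cf_den b i dvd cf_den b j" "cf_den b j dvd cf_den b i"
    using eq coprime_cf[of b i] coprime_cf[of b j]
    by (metis coprime_commute coprime_dvd_mult_right_iff dvd_triv_right)+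
  then show ?thesis
    by (rule zdvd_antisym_abs)
qed

lemma cf_convergent_eq_iff: "cf_convergent b i = cf_convergent b j \<longleftrightarrow> cf_cross b i j = 0"
proof -
  have "cf_num b i \<noteq> 0" if "cf_den b i = 0" for i
    using that coprime_cf[of b i] by auto
  moreover have "of_int (cf_num b i) * (of_int (cf_den b j) :: complex)
      = of_int (cf_num b j) * of_int (cf_den b i)
    \<longleftrightarrow> cf_num b i * cf_den b j = cf_num b j * cf_den b i"
    by (metis of_int_eq_iff of_int_mult)
  ultimately show ?thesis
    by (auto simp: cf_convergent_def cf_cross_def field_simps)
qed

lemma cf_convergent_eq_0_iff: "cf_convergent b n = Some 0 \<longleftrightarrow> cf_num b n = 0"
  using coprime_cf[of b n] by (auto simp: cf_convergent_def)

section \<open>Membership in \<open>O_hat\<close> through cross determinants\<close>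

lemma word_vertex_eq:
  assumes "k \<le> length w"
  shows "word_vertex w k = cf_convergent ((!) w) k"
proof (cases k)
  case (Suc k')
  have "cf_convergent ((!) (take k w)) k = cf_convergent ((!) w) k"
    unfolding cf_convergent_def using cf_cong[of k "(!) (take k w)" "(!) w"] by simp
  with Suc assms show ?thesis
    by (simp add: cf_value_def min_def)
qed (simp add: cf_convergent_def)

lemma O_hat_iff:
  "w \<in> O_hat \<longleftrightarrow> w \<noteq> [] \<and> cf_num ((!) w) (length w) = 0 \<and>
     (\<forall>i j. i < j \<and> j \<le> length w \<longrightarrow> cf_cross ((!) w) i j \<noteq> 0)"
proof -
  have "inj_on (word_vertex w) {0..length w} \<longleftrightarrow>
      (\<forall>i j. i < j \<and> j \<le> length w \<longrightarrow> word_vertex w i \<noteq> word_vertex w j)" (is "?L \<longleftrightarrow> ?R")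
  proof
    show ?R if ?L
      using inj_onD[OF that] by force
    show ?L if ?R
      by (rule linorder_inj_onI) (use that in auto)
  qed
  also have "\<dots> \<longleftrightarrow> (\<forall>i j. i < j \<and> j \<le> length w \<longrightarrow> cf_cross ((!) w) i j \<noteq> 0)"
    by (auto simp: word_vertex_eq cf_convergent_eq_iff)
  finally show ?thesis
    by (simp add: O_hat_def word_vertex_eq cf_convergent_eq_0_iff)
qed

lemma cf_cross_cong:
  assumes "\<And>n. n < j \<Longrightarrow> b n = b' n" "i \<le> j"
  shows "cf_cross b i j = cf_cross b' i j"
  using assms cf_cong[of i b b'] cf_cong[of j b b'] by (simp add: cf_cross_def)

text \<open>The Moebius map of the entries before index \<open>Suc r\<close> sends infinity to
  convergent \<open>Suc r\<close> and 0 to convergent \<open>r\<close>. It turns vertex k of the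
  word into convergent \<open>Suc r + k\<close> of \<open>b\<close>, and the final value 0 into a
  return to convergent \<open>r\<close>.\<close>

lemma map_upt_in_O_hat_iff:
  "map b [Suc r..<t] \<in> O_hat \<longleftrightarrow> Suc r < t \<and> cf_cross b r t = 0 \<and>
     (\<forall>i j. Suc r \<le> i \<and> i < j \<and> j \<le> t \<longrightarrow> cf_cross b i j \<noteq> 0)"
proof (cases "Suc r < t")
  case True
  then obtain k where k: "t = Suc r + k"
    using less_imp_add_positive by blast
  let ?w = "map b [Suc r..<t]" and ?b = "\<lambda>n. b (Suc r + n)"
  have nth: "?w ! n = ?b n" if "n < k" for n
    using that k by (simp del: upt_Suc)
  have "cf_num ((!) ?w) k = cf_num ?b k"
    using nth by (intro cf_cong) auto
  also have "\<dots> = cf_cross b r t"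
    using cf_cross_shift[of b r 0 "Suc k"] by (simp add: cf_cross_0_left cf_Suc_shift k)
  finally have 1: "cf_num ((!) ?w) k = cf_cross b r t" .
  have 2: "cf_cross ((!) ?w) i j = cf_cross b (Suc r + i) (Suc r + j)" if "i < j" "j \<le> k" for i j
    unfolding cf_cross_shift using that nth by (intro cf_cross_cong) auto
  have "(\<forall>i j. i < j \<and> j \<le> k \<longrightarrow> cf_cross ((!) ?w) i j \<noteq> 0) \<longleftrightarrow>
    (\<forall>i j. Suc r \<le> i \<and> i < j \<and> j \<le> t \<longrightarrow> cf_cross b i j \<noteq> 0)" (is "?L \<longleftrightarrow> ?R")
  proof
    assume ?L
    show ?R
    proof (intro allI impI)
      fix i j assume ij: "Suc r \<le> i \<and> i < j \<and> j \<le> t"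
      then have "i - Suc r < j - Suc r" "j - Suc r \<le> k"
        using k by auto
      then show "cf_cross b i j \<noteq> 0"
        using \<open>?L\<close>[rule_format, of "i - Suc r" "j - Suc r"] 2[of "i - Suc r" "j - Suc r"] ij
        by (simp del: upt_Suc)
    qed
  next
    assume ?R
    then show ?L
      using 2 k by simp
  qed
  then show ?thesis
    using True 1 k unfolding O_hat_iff by auto
qed (simp add: O_hat_iff)

section \<open>Sublists and substrings of tails\<close>

lemma sublist_map_upt:
  assumes "sublist x (map b [r..<t])" "r \<le> t"
  obtains r' t' where "r \<le> r'" "r' \<le> t'" "t' \<le> t" "x = map b [r'..<t']"
proof -
  obtain ps ss where eq: "map b [r..<t] = ps @ x @ ss"
    using assms by (auto simp: sublist_def)
  let ?r = "r + length ps"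
  have len: "length ps + length x + length ss = t - r"
    using arg_cong[OF eq, of length] by simp
  have "x = take (length x) (drop (length ps) (map b [r..<t]))"
    by (simp add: eq)
  also have "\<dots> = map b [?r..<?r + length x]"
    using len assms(2) by (simp add: drop_map take_map)
  finally show ?thesis
    using len assms(2) by (intro that[of ?r "?r + length x"]) auto
qed

lemma substring_of_tail_iff:
  "substring_of_seq x (\<lambda>i. b (n + i)) \<longleftrightarrow> (\<exists>r s. n \<le> r \<and> r \<le> s \<and> x = map b [r..<Suc s])"
proof -
  have shift: "map (\<lambda>i. b (n + i)) [r..<Suc s] = map b [n + r..<Suc (n + s)]" for r s
    by (rule nth_equalityI) (simp_all add: add.assoc del: upt_Suc)
  show ?thesis
    unfolding substring_of_seq_def
  proof (intro iffI; elim exE conjE)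
    fix r s assume "r \<le> s" "x = map (\<lambda>i. b (n + i)) [r..<Suc s]"
    then show "\<exists>r s. n \<le> r \<and> r \<le> s \<and> x = map b [r..<Suc s]"
      by (intro exI[of _ "n + r"] exI[of _ "n + s"]) (simp add: shift del: upt_Suc)
  next
    fix r s assume "n \<le> r" "r \<le> s" "x = map b [r..<Suc s]"
    then show "\<exists>r s. r \<le> s \<and> x = map (\<lambda>i. b (n + i)) [r..<Suc s]"
      by (intro exI[of _ "r - n"] exI[of _ "s - n"]) (simp add: shift del: upt_Suc)
  qed
qed

lemma sublist_substring_of_tail:
  assumes "sublist x (map b [r..<t])" "x \<noteq> []" "n \<le> r"
  shows "substring_of_seq x (\<lambda>i. b (n + i))"
proof -
  have "map b [r..<t] \<noteq> []"
    using assms(1,2) by (metis sublist_Nil_right)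
  then have "r \<le> t" by simp
  then obtain r' t' where r't': "r \<le> r'" "r' \<le> t'" "x = map b [r'..<t']"
    using sublist_map_upt[OF assms(1)] by metis
  then have "r' < t'"
    using assms(2) by auto
  then obtain s where "t' = Suc s"
    by (cases t') auto
  then show ?thesis
    using r't' \<open>r' < t'\<close> assms(3) unfolding substring_of_tail_iff
    by (intro exI[of _ r'] exI[of _ s]) auto
qed

section \<open>Symmetry and absence of redundancy\<close>

lemma map_uminus_in_O_hat: "map uminus w \<in> O_hat \<longleftrightarrow> w \<in> O_hat"
proof -
  let ?b = "\<lambda>i. - (w ! i)"
  have "cf_num ((!) (map uminus w)) (length w) = cf_num ?b (length w)"
    by (intro cf_cong) simp
  moreover have "cf_cross ((!) (map uminus w)) i j = cf_cross ?b i j" if "i < j" "j \<le> length w" for i j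
    using that by (intro cf_cross_cong) auto
  ultimately show ?thesis
    unfolding O_hat_iff by (simp add: cf_uminus cf_cross_uminus)
qed

lemma symmetric_O_hat: "symmetric_words O_hat"
proof -
  have "cf_cross ((!) [0]) i j \<noteq> 0" if "i < j" "j \<le> Suc 0" for i j
  proof -
    have "i = 0" "j = Suc 0"
      using that by auto
    then show ?thesis
      by (simp add: cf_cross_Suc)
  qed
  then have "[0] \<in> O_hat"
    by (simp add: O_hat_iff)
  then show ?thesis
    by (auto simp: symmetric_words_def word_closure_def map_uminus_in_O_hat)
qed

text \<open>A proper subword in \<open>O_hat\<close> would repeat a vertex of the longer word: a
  proper prefix reaches 0 too early, and any other subword returns to the vertex just before its
  start.\<close>

lemma without_redundancy_O_hat: "without_redundancy O_hat"
  unfolding without_redundancy_def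
proof (intro ballI impI notI)
  fix x y assume x: "x \<in> O_hat" and y: "y \<in> O_hat" and "x \<noteq> y" and sub: "sublist x y"
  let ?b = "(!) y"
  have y_eq: "y = map ?b [0..<length y]"
    by (simp add: map_nth)
  obtain r t where rt: "r \<le> t" "t \<le> length y" "x = map ?b [r..<t]"
    using sub y_eq sublist_map_upt[of x ?b 0 "length y"] by auto
  show False
  proof (cases r)
    case 0
    then have "t < length y"
      using rt y_eq \<open>x \<noteq> y\<close> by (metis le_neq_implies_less)
    moreover have "cf_num ((!) x) t = 0"
      using x rt 0 by (simp add: O_hat_iff)
    moreover have "cf_num ((!) x) t = cf_num ?b t"
      using rt 0 by (intro cf_cong) simp
    ultimately have "cf_cross ?b t (length y) = 0"
      using y by (simp add: cf_cross_def O_hat_iff)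
    then show False
      using y \<open>t < length y\<close> by (simp add: O_hat_iff)
  next
    case (Suc r')
    then have "cf_cross ?b r' t = 0" "r' < t"
      using x rt by (simp_all add: map_upt_in_O_hat_iff)
    then show False
      using y rt by (simp add: O_hat_iff)
  qed
qed

text \<open>If convergents \<open>i\<close> and \<open>j\<close> coincide while all closer pairs are
  distinct, the entries strictly between these indices form a word of \<open>O_hat\<close>.\<close>

lemma O_hat_free_tail_imp_distinct:
  assumes free: "\<And>w. w \<in> O_hat \<Longrightarrow> \<not> substring_of_seq w (\<lambda>i. b (n + i))"
    and "n \<le> i" "i < j"
  shows "cf_cross b i j \<noteq> 0"
  using assms(2,3)
proof (induction "j - i" arbitrary: i j rule: less_induct)
  case less
  show ?case
  proof
    assume zero: "cf_cross b i j = 0"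
    have "j \<noteq> Suc i"
      using zero cf_cross_Suc[of b i] by auto
    moreover have "cf_cross b i' j' \<noteq> 0" if "Suc i \<le> i'" "i' < j'" "j' \<le> j" for i' j'
      using that less.prems less.hyps[of j' i'] by force
    ultimately have "map b [Suc i..<j] \<in> O_hat"
      using zero less.prems by (auto simp: map_upt_in_O_hat_iff)
    moreover have "substring_of_seq (map b [Suc i..<j]) (\<lambda>k. b (n + k))"
      using less.prems \<open>j \<noteq> Suc i\<close> by (intro sublist_substring_of_tail[of _ b "Suc i" j]) auto
    ultimately show False
      using free by blast
  qed
qed

section \<open>Farey intervals and paths with distinct vertices\<close>

text \<open>The integers x y' and x' y are consecutive, so their product cannot be negative. This is
  why an edge of the Farey graph does not cross another.\<close>

lemma int_sign_change_impossible:
  fixes x y x' y' :: int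
  assumes "x * y' - x' * y = 1" "x * y * (x' * y') < 0"
  shows False
proof -
  have "False" if "u - v = 1" "u * v < 0" for u v :: int
    using that by (auto simp: mult_less_0_iff)
  moreover have "(x * y') * (x' * y) < 0"
    using assms(2) by (simp add: ac_simps)
  ultimately show False
    using assms(1) by blast
qed

text \<open>Two visits to the same point p/q would be a coincidence of convergents, so there is at
  most one from \<open>n\<close> on. The choice \<open>p = 1\<close>, \<open>q = 0\<close> is the
  point infinity.\<close>

lemma eventually_cf_avoids:
  assumes distinct: "\<And>i j. n \<le> i \<Longrightarrow> i < j \<Longrightarrow> cf_cross b i j \<noteq> 0"
    and "p \<noteq> 0 \<or> q \<noteq> 0"
  shows "\<forall>\<^sub>F m in sequentially. cf_num b m * q \<noteq> cf_den b m * p"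
proof (cases "\<exists>i\<ge>n. cf_num b i * q = cf_den b i * p")
  case True
  then obtain i where i: "n \<le> i" "cf_num b i * q = cf_den b i * p"
    by blast
  have "cf_num b j * q \<noteq> cf_den b j * p" if "j > i" for j
  proof
    assume j: "cf_num b j * q = cf_den b j * p"
    have "cf_cross b i j * q = 0" "cf_cross b i j * p = 0"
      using i(2) j by (simp_all add: cf_cross_def left_diff_distrib) algebra+
    then show False
      using distinct[OF i(1) that] assms(2) by auto
  qed
  then show ?thesis
    using eventually_gt_at_top[of i] by (rule eventually_mono[rotated])
next
  case False
  then show ?thesis
    by (intro eventually_mono[OF eventually_ge_at_top[of n]]) blast
qed

text \<open>The factors of \<open>L m\<close> are the coordinates of convergent \<open>m\<close> in
  the basis (p, q), (r, s) of the integer lattice, and the sign of \<open>L m\<close> tells the side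
  of the interval. Being free of division, \<open>L\<close> also makes sense at infinity.\<close>

lemma farey_gap_int:
  assumes distinct: "\<And>i j. n \<le> i \<Longrightarrow> i < j \<Longrightarrow> cf_cross b i j \<noteq> 0"
    and det: "r * q - p * s = (1::int)"
  defines "L \<equiv> \<lambda>m. (cf_num b m * q - cf_den b m * p) * (r * cf_den b m - s * cf_num b m)"
  shows "(\<forall>\<^sub>F m in sequentially. L m > 0) \<or> (\<forall>\<^sub>F m in sequentially. L m < 0)"
proof -
  have "\<forall>\<^sub>F m in sequentially. cf_num b m * q \<noteq> cf_den b m * p"
    "\<forall>\<^sub>F m in sequentially. cf_num b m * s \<noteq> cf_den b m * r"
    using det by (auto intro!: eventually_cf_avoids[OF distinct])
  then have "\<forall>\<^sub>F m in sequentially. L m \<noteq> 0"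
    by eventually_elim (simp add: L_def mult.commute)
  then obtain N where N: "\<And>m. m \<ge> N \<Longrightarrow> L m \<noteq> 0"
    by (auto simp: eventually_sequentially)
  have step: "\<not> L m * L (Suc m) < 0" for m
  proof
    assume "L m * L (Suc m) < 0"
    \<comment> \<open>Multiplicativity of the determinant under the change of basis.\<close>
    moreover have "(cf_num b m * q - cf_den b m * p) * (r * cf_den b (Suc m) - s * cf_num b (Suc m))
        - (cf_num b (Suc m) * q - cf_den b (Suc m) * p) * (r * cf_den b m - s * cf_num b m)
      = (r * q - p * s) * cf_cross b m (Suc m)"
      by (simp add: cf_cross_def algebra_simps del: cf_num.simps cf_den.simps)
    then have "(cf_num b m * q - cf_den b m * p) * (r * cf_den b (Suc m) - s * cf_num b (Suc m))
        - (cf_num b (Suc m) * q - cf_den b (Suc m) * p) * (r * cf_den b m - s * cf_num b m) = 1"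
      by (simp only: det cf_cross_Suc)
    ultimately show False
      unfolding L_def by (metis int_sign_change_impossible)
  qed
  have same: "0 < L m \<longleftrightarrow> 0 < L N" if "m \<ge> N" for m
    using that
  proof (induction m rule: dec_induct)
    case (step m)
    then show ?case
      using \<open>\<not> L m * L (Suc m) < 0\<close> N[of m] N[of "Suc m"]
      by (simp add: mult_less_0_iff) linarith
  qed simp
  show ?thesis
  proof (cases "0 < L N")
    case True
    then have "0 < L m" if "m \<ge> N" for m
      using same[OF that] by simp
    then show ?thesis
      by (intro disjI1 eventually_sequentiallyI)
  next
    case False
    then have "L m < 0" if "m \<ge> N" for m
      using same[OF that] N[OF that] by simp
    then show ?thesis
      by (intro disjI2 eventually_sequentiallyI)
  qed
qed

lemma farey_gap:
  fixes b :: "nat \<Rightarrow> int" and p q r s :: int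
  assumes distinct: "\<And>i j. n \<le> i \<Longrightarrow> i < j \<Longrightarrow> cf_cross b i j \<noteq> 0"
    and det: "r * q - p * s = 1" and pos: "q > 0" "s > 0"
  defines "x \<equiv> \<lambda>m. real_of_int (cf_num b m) / real_of_int (cf_den b m)"
  shows "(\<forall>\<^sub>F m in sequentially. p / q < x m \<and> x m < r / s) \<or>
         (\<forall>\<^sub>F m in sequentially. x m < p / q \<or> r / s < x m)"
proof -
  define L where "L m = (cf_num b m * q - cf_den b m * p) * (r * cf_den b m - s * cf_num b m)" for m
  \<comment> \<open>Division by zero yields 0, so \<open>x m\<close> is the true convergent only
    once the value infinity is excluded.\<close>
  have den: "\<forall>\<^sub>F m in sequentially. cf_den b m \<noteq> 0"
    using eventually_cf_avoids[OF distinct, where p = 1 and q = 0] by simp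
  have "real_of_int (r * q - p * s) = 1"
    by (simp only: det of_int_1)
  then have less: "p / q < r / s"
    using pos by (simp add: field_simps)
  have L: "real_of_int (L m) = (cf_den b m)\<^sup>2 * q * s * ((x m - p / q) * (r / s - x m))"
    if "cf_den b m \<noteq> 0" for m
    using that pos by (simp add: L_def x_def field_simps power2_eq_square)
  have scale: "0 < (cf_den b m)\<^sup>2 * real_of_int q * real_of_int s" if "cf_den b m \<noteq> 0" for m
    using that pos by simp
  have in_gap: "p / q < x m \<and> x m < r / s" if "L m > 0" "cf_den b m \<noteq> 0" for m
  proof -
    have "0 < real_of_int (L m)" using that by simp
    then have "0 < (x m - p / q) * (r / s - x m)"
      using mult_less_cancel_left_pos[OF scale[OF that(2)], of 0] unfolding L[OF that(2)] by simp
    then show ?thesis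
      using less by (auto simp: zero_less_mult_iff)
  qed
  have out_gap: "x m < p / q \<or> r / s < x m" if "L m < 0" "cf_den b m \<noteq> 0" for m
  proof -
    have "real_of_int (L m) < 0" using that by simp
    then have "(x m - p / q) * (r / s - x m) < 0"
      using mult_less_cancel_left_pos[OF scale[OF that(2)], of _ 0] unfolding L[OF that(2)] by simp
    then show ?thesis
      by (auto simp: mult_less_0_iff)
  qed
  from farey_gap_int[OF distinct det] show ?thesis
    unfolding L_def[symmetric]
  proof
    assume "\<forall>\<^sub>F m in sequentially. L m > 0"
    with den have "\<forall>\<^sub>F m in sequentially. p / q < x m \<and> x m < r / s"
      by eventually_elim (rule in_gap)
    then show ?thesis ..
  next
    assume "\<forall>\<^sub>F m in sequentially. L m < 0"
    with den have "\<forall>\<^sub>F m in sequentially. x m < p / q \<or> r / s < x m"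
      by eventually_elim (rule out_gap)
    then show ?thesis ..
  qed
qed

text \<open>Induction on \<open>N\<close>: the mediant (p + r)/(q + s) cuts a Farey interval into
  two Farey intervals, \<open>farey_gap\<close> selects one of them, and q + s grows by at least
  1.\<close>

lemma farey_refine:
  fixes b :: "nat \<Rightarrow> int" and k :: int
  assumes distinct: "\<And>i j. n \<le> i \<Longrightarrow> i < j \<Longrightarrow> cf_cross b i j \<noteq> 0"
  defines "x \<equiv> \<lambda>m. real_of_int (cf_num b m) / real_of_int (cf_den b m)"
  assumes base: "\<forall>\<^sub>F m in sequentially. of_int k < x m \<and> x m < of_int k + 1"
  shows "\<exists>p q r s :: int. r * q - p * s = 1 \<and> q > 0 \<and> s > 0 \<and> q + s \<ge> int N \<and>
    (\<forall>\<^sub>F m in sequentially. p / q < x m \<and> x m < r / s)"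
proof (induction N)
  case 0
  show ?case
    using base by (intro exI[of _ k] exI[of _ 1] exI[of _ "k + 1"]) auto
next
  case (Suc N)
  then obtain p q r s :: int where
    *: "r * q - p * s = 1" "q > 0" "s > 0" "q + s \<ge> int N"
    and ev: "\<forall>\<^sub>F m in sequentially. p / q < x m \<and> x m < r / s"
    by blast
  have det1: "(p + r) * q - p * (q + s) = 1" and det2: "r * (q + s) - (p + r) * s = 1"
    using *(1) by (simp_all add: algebra_simps)
  from farey_gap[OF distinct det1] *
  consider "\<forall>\<^sub>F m in sequentially. p / q < x m \<and> x m < (p + r) / (q + s)"
    | "\<forall>\<^sub>F m in sequentially. x m < p / q \<or> (p + r) / (q + s) < x m"
    unfolding x_def by fastforce
  then show ?case
  proof cases
    case 1
    then show ?thesis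
      using * det1 by (intro exI[of _ p] exI[of _ q] exI[of _ "p + r"] exI[of _ "q + s"]) auto
  next
    case 2
    with ev have "\<forall>\<^sub>F m in sequentially. (p + r) / (q + s) < x m \<and> x m < r / s"
      by eventually_elim auto
    then show ?thesis
      using * det2 by (intro exI[of _ "p + r"] exI[of _ "q + s"] exI[of _ r] exI[of _ s]) auto
  qed
qed

section \<open>Convergence in the Riemann sphere\<close>

lemma limitin_riemann_sphere_Some:
  "(f \<longlongrightarrow> l) F \<Longrightarrow> limitin riemann_sphere (\<lambda>n. Some (f n)) (Some l) F"
  using continuous_map_limit[OF continuous_map_Some, of euclidean f l F]
  by (simp add: riemann_sphere_def o_def)

lemma limitin_riemann_sphere_None:
  assumes "filterlim f at_infinity F"
  shows "limitin riemann_sphere (\<lambda>n. Some (f n)) None F"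
  unfolding limitin_def riemann_sphere_def
proof (intro conjI allI impI)
  fix U :: "complex option set"
  assume "openin (Alexandroff_compactification euclidean) U \<and> None \<in> U"
  then obtain C where C: "compact C" "U = insert None (Some ` (- C))"
    by (auto simp: openin_Alexandroff_compactification Compl_eq_Diff_UNIV)
  then obtain B where B: "\<And>z. z \<in> C \<Longrightarrow> norm z \<le> B" "B > 0"
    using bounded_pos compact_imp_bounded by metis
  have "\<forall>\<^sub>F n in F. norm (f n) \<ge> B + 1"
    using assms B(2) by (auto simp: filterlim_at_infinity[of 0])
  then show "\<forall>\<^sub>F n in F. Some (f n) \<in> U"
    by eventually_elim (use B C in fastforce)
qed simp

text \<open>The filter \<open>at_infinity\<close> allows the quotients to grow in modulus with
  varying sign: the sphere has a single point at infinity.\<close>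

lemma cf_converges_if_real:
  fixes b :: "nat \<Rightarrow> int"
  defines "x \<equiv> \<lambda>m. real_of_int (cf_num b m) / real_of_int (cf_den b m)"
  assumes den: "\<forall>\<^sub>F m in sequentially. cf_den b m \<noteq> 0"
    and lim: "x \<longlonglongrightarrow> l \<or> filterlim x at_infinity sequentially"
  shows "cf_converges b"
proof -
  have "\<exists>l. limitin riemann_sphere (\<lambda>m. Some (complex_of_real (x m))) l sequentially"
    using lim
  proof
    assume "x \<longlonglongrightarrow> l"
    then show ?thesis
      using limitin_riemann_sphere_Some tendsto_of_real by blast
  next
    assume "filterlim x at_infinity sequentially"
    then have "filterlim (\<lambda>m. complex_of_real (x m)) at_infinity sequentially"
      by (simp add: filterlim_at_infinity[of 0])
    then show ?thesis
      using limitin_riemann_sphere_None by blast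
  qed
  then obtain l' where l': "limitin riemann_sphere (\<lambda>m. Some (complex_of_real (x m))) l' sequentially" ..
  have "\<forall>\<^sub>F m in sequentially. Some (complex_of_real (x m)) = cf_convergent b m"
    using den by eventually_elim (simp add: cf_convergent_def x_def)
  from limitin_transform_eventually[OF this l'] show ?thesis
    unfolding cf_converges_def by blast
qed

lemma distinct_imp_cf_converges:
  fixes b :: "nat \<Rightarrow> int"
  assumes distinct: "\<And>i j. n \<le> i \<Longrightarrow> i < j \<Longrightarrow> cf_cross b i j \<noteq> 0"
  shows "cf_converges b"
proof -
  define x where "x m = real_of_int (cf_num b m) / real_of_int (cf_den b m)" for m
  have den: "\<forall>\<^sub>F m in sequentially. cf_den b m \<noteq> 0"
    using eventually_cf_avoids[OF distinct, where p = 1 and q = 0] by simp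
  have gap: "(\<forall>\<^sub>F m in sequentially. of_int k < x m \<and> x m < of_int k + 1) \<or>
      (\<forall>\<^sub>F m in sequentially. x m < of_int k \<or> of_int k + 1 < x m)" for k :: int
    using farey_gap[OF distinct, where p = k and q = 1 and r = "k + 1" and s = 1]
    by (simp add: x_def)
  show ?thesis
  proof (cases "\<exists>k. \<forall>\<^sub>F m in sequentially. of_int k < x m \<and> x m < of_int k + 1")
    case True
    then obtain k where k: "\<forall>\<^sub>F m in sequentially. of_int k < x m \<and> x m < of_int k + 1"
      by blast
    have "Cauchy x"
    proof (rule metric_CauchyI)
      fix e :: real assume "e > 0"
      obtain N where N: "1 / e < real N"
        using reals_Archimedean2 by blast
      obtain p q r s :: int where
        *: "r * q - p * s = 1" "q > 0" "s > 0" "q + s \<ge> int (N + 1)"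
        and ev: "\<forall>\<^sub>F m in sequentially. p / q < x m \<and> x m < r / s"
        using farey_refine[OF distinct, where N = "N + 1"] k unfolding x_def by blast
      \<comment> \<open>Expanded, this gives q s \<ge> q + s - 1 \<ge> N, so the interval, of length
        1/(q s), is shorter than \<open>e\<close>.\<close>
      have "0 \<le> (q - 1) * (s - 1)"
        using * by simp
      then have "int N \<le> q * s"
        using *(4) by (simp add: algebra_simps)
      then have "real N \<le> real_of_int q * real_of_int s"
        by (metis of_int_le_iff of_int_mult of_int_of_nat_eq)
      then have "1 / e < real_of_int q * real_of_int s"
        using N by linarith
      moreover have "r / s - p / q = real_of_int (r * q - p * s) / (real_of_int q * real_of_int s)"
        using *(2,3) by (simp add: field_simps)
      then have "r / s - p / q = 1 / (real_of_int q * real_of_int s)"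
        by (simp only: *(1) of_int_1)
      ultimately have width: "r / s - p / q < e"
        using \<open>e > 0\<close> * by (simp add: field_simps)
      obtain M where M: "\<And>m. m \<ge> M \<Longrightarrow> p / q < x m \<and> x m < r / s"
        using ev by (auto simp: eventually_sequentially)
      have "dist (x m) (x m') < e" if "m \<ge> M" "m' \<ge> M" for m m'
        using M[OF that(1)] M[OF that(2)] width
        unfolding dist_real_def by (auto simp: abs_less_iff)
      then show "\<exists>M. \<forall>m\<ge>M. \<forall>n\<ge>M. dist (x m) (x n) < e"
        by blast
    qed
    then obtain l where "x \<longlonglongrightarrow> l"
      by (auto simp: Cauchy_convergent_iff convergent_def)
    then show ?thesis
      using cf_converges_if_real[OF den, of l] by (simp add: x_def[abs_def])
  next
    case False
    have "\<forall>\<^sub>F m in sequentially. norm (x m) \<ge> B" for B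
    proof -
      \<comment> \<open>The finitely many unit intervals starting in \<open>?K\<close> cover all
        reals of modulus below \<open>B\<close>, and each is finally avoided.\<close>
      let ?K = "{- \<lceil>B\<rceil> - 1..\<lceil>B\<rceil> + 1}"
      have "\<forall>\<^sub>F m in sequentially. \<forall>k\<in>?K. x m < of_int k \<or> of_int k + 1 < x m"
        using False gap by (intro eventually_ball_finite) auto
      then show ?thesis
      proof eventually_elim
        case (elim m)
        show ?case
        proof (rule ccontr)
          assume "\<not> norm (x m) \<ge> B"
          then have "\<lfloor>x m\<rfloor> \<in> ?K"
            by (auto simp: abs_less_iff) linarith+
          from bspec[OF elim this] show False
            by linarith
        qed
      qed
    qed
    then have "filterlim x at_infinity sequentially"
      by (simp add: filterlim_at_infinity[of 0])
    then show ?thesis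
      using cf_converges_if_real[OF den, of 0] by (simp add: x_def[abs_def])
  qed
qed

lemma divergent_in_Ex_O_hat:
  assumes "\<not> cf_converges b"
  shows "b \<in> Ex_cf O_hat"
proof (rule ccontr)
  assume "b \<notin> Ex_cf O_hat"
  then obtain n where "\<And>w. w \<in> O_hat \<Longrightarrow> \<not> substring_of_seq w (\<lambda>i. b (n + i))"
    by (auto simp: Ex_cf_def)
  then show False
    using assms O_hat_free_tail_imp_distinct distinct_imp_cf_converges by metis
qed

lemma exclusion_set_O_hat: "exclusion_set O_hat"
  unfolding exclusion_set_def
  using symmetric_O_hat without_redundancy_O_hat divergent_in_Ex_O_hat by (auto simp: O_hat_def)

section \<open>Divergent periodic continued fractions\<close>

text \<open>Along the indices i, i + P, i + 2P, ... the sequence is constant, and limits in the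
  Hausdorff sphere are unique.\<close>

lemma limitin_riemann_sphere_periodic:
  assumes lim: "limitin riemann_sphere f l sequentially"
    and per: "\<And>m. f (m + P) = f m" and "P > 0"
  shows "f i = l"
proof -
  have const: "f (i + t * P) = f i" for t
  proof (induction t)
    case (Suc t)
    then show ?case
      using per[of "i + t * P"] by (simp add: ac_simps)
  qed simp
  have "strict_mono (\<lambda>t. i + t * P)"
    using \<open>P > 0\<close> by (auto simp: strict_mono_def)
  from limitin_subsequence[OF this lim] have "limitin riemann_sphere (\<lambda>t. f i) l sequentially"
    by (simp add: o_def const)
  moreover have "f i \<in> topspace riemann_sphere"
    by (cases "f i") (auto simp: riemann_sphere_def)
  then have "limitin riemann_sphere (\<lambda>t. f i) (f i) sequentially"
    by simp
  moreover have "Hausdorff_space riemann_sphere"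
    by (simp add: riemann_sphere_def Hausdorff_space_Alexandroff_compactification
        locally_compact_space_euclidean)
  ultimately show ?thesis
    using limitin_Hausdorff_unique trivial_limit_sequentially by metis
qed

text \<open>The condition on the sum is what makes the matrix of the whole period the identity.\<close>

lemma cf_periodic:
  fixes b :: "nat \<Rightarrow> int" and k :: nat
  defines "P \<equiv> 2 * Suc k + 2"
  assumes zero: "cf_num b (Suc k) = 0"
    and rep: "\<And>n. n < Suc k \<Longrightarrow> b (Suc (Suc k) + n) = b n"
    and sum: "b (Suc k) + b (Suc (2 * Suc k)) = 2 * cf_den b (Suc k) * cf_den b k"
    and per: "\<And>m. b (m + P) = b m"
  shows "cf_num b (m + P) = cf_num b m \<and> cf_den b (m + P) = cf_den b m"
proof -
  define e g where "e = cf_den b (Suc k)" and "g = cf_den b k"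
  \<comment> \<open>With \<open>cf_num b (Suc k) = 0\<close>, the unit determinant of neighbouring
    convergents reduces to this product, which forces e = 1 or e = -1.\<close>
  have "cf_num b k * e = 1"
    using cf_cross_Suc[of b k] zero by (simp add: cf_cross_def e_def)
  then have num_k: "cf_num b k = e" and sq: "e * e = 1"
    by (auto simp: zmult_eq_1_iff)
  have add: "cf_num b (Suc (Suc k) + i) = - (cf_num b i * e)"
    "cf_den b (Suc (Suc k) + i) = cf_num b i * (b (Suc k) * e - g) - cf_den b i * e"
    if "i \<le> Suc k" for i
  proof -
    have "cf_num (\<lambda>n. b (Suc (Suc k) + n)) i = cf_num b i"
      "cf_den (\<lambda>n. b (Suc (Suc k) + n)) i = cf_den b i"
      using that rep by (auto intro!: cf_cong)
    then show "cf_num b (Suc (Suc k) + i) = - (cf_num b i * e)"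
      "cf_den b (Suc (Suc k) + i) = cf_num b i * (b (Suc k) * e - g) - cf_den b i * e"
      unfolding cf_add[of b "Suc k" i]
      by (simp_all add: zero num_k e_def[symmetric] g_def[symmetric])
  qed
  have idx: "Suc (Suc k) + k = 2 * Suc k" "Suc (Suc k) + Suc k = Suc (2 * Suc k)"
    "P = Suc (Suc (2 * Suc k))"
    by (simp_all add: P_def)
  have P2: "cf_num b (2 * Suc k) = - 1" "cf_den b (2 * Suc k) = b (Suc k) - 2 * e * g"
    using add[of k] sq unfolding idx num_k g_def[symmetric]
    by (simp_all add: algebra_simps)
  have P1: "cf_num b (Suc (2 * Suc k)) = 0" "cf_den b (Suc (2 * Suc k)) = - 1"
    using add[of "Suc k"] sq unfolding idx zero e_def[symmetric] by simp_all
  \<comment> \<open>The denominator is 2 e g minus the sum of the two separating entries, hence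
    0.\<close>
  have P0: "cf_num b P = 1" "cf_den b P = 0"
    using sum unfolding idx(3) cf_num.simps(3) cf_den.simps(3) P1 P2 e_def[symmetric] g_def[symmetric]
    by simp_all
  have "cf_num b (Suc P) = b P * cf_num b P - cf_num b (Suc (2 * Suc k))"
    "cf_den b (Suc P) = b P * cf_den b P - cf_den b (Suc (2 * Suc k))"
    unfolding idx(3) by (rule cf_num.simps(3) cf_den.simps(3))+
  then have PS: "cf_num b (Suc P) = b 0" "cf_den b (Suc P) = 1"
    using per[of 0] unfolding P0 P1 by simp_all
  \<comment> \<open>Two consecutive pairs recur after \<open>P\<close> steps and the coefficients
    have period \<open>P\<close>, so the recurrence propagates the equality.\<close>
  show ?thesis
  proof (induction m rule: induct_nat_012)
    case (ge2 m)
    then show ?case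
      using per[of "Suc m"] by simp
  qed (simp_all add: P0 PS)
qed

lemma sublist_map_nth:
  assumes "j \<le> length w"
  shows "sublist (map ((!) w) [i..<j]) w"
proof -
  have "map ((!) w) [i..<j] = take (j - i) (drop i w)"
    using assms by (intro nth_equalityI) auto
  then show ?thesis
    by (metis sublist_drop sublist_order.order_trans sublist_take)
qed

lemma sublist_of_O_hat:
  assumes X: "exclusion_set X" "finite X" and w: "w \<in> O_hat"
  obtains x where "x \<in> X" "sublist x w"
proof -
  have "w \<noteq> []" and w0: "cf_num ((!) w) (length w) = 0"
    using w by (simp_all add: O_hat_iff)
  then obtain k where k: "length w = Suc k"
    by (cases w) auto
  \<comment> \<open>\<open>a\<close> is the sum that \<open>cf_periodic\<close> demands of the two
    separators \<open>c\<close> and \<open>a - c\<close>.\<close>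
  define a where "a = 2 * cf_den ((!) w) (Suc k) * cf_den ((!) w) k"
  define F where "F = \<Union> (set ` X)"
  \<comment> \<open>Avoiding the image under \<open>(-) a\<close> keeps the second separator
    \<open>a - c\<close> out of \<open>F\<close> as well.\<close>
  have "finite (F \<union> (-) a ` F)"
    using X by (simp add: F_def)
  then obtain c where c: "c \<notin> F \<union> (-) a ` F"
    using ex_new_if_finite[OF infinite_UNIV_int] by blast
  then have fresh: "c \<notin> F" "a - c \<notin> F"
    by (auto simp: image_iff)
  \<comment> \<open>A block of length \<open>M\<close> is \<open>w\<close> followed by one
    separator; the separators alternate, so the period is \<open>2 * M\<close>.\<close>
  define M where "M = Suc (Suc k)"
  define b where "b m = (if m mod M < Suc k then w ! (m mod M)
      else if even (m div M) then c else a - c)" for m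
  have b_w: "b n = w ! n" if "n < Suc k" for n
    using that by (simp add: b_def M_def)
  have num: "cf_num b n = cf_num ((!) w) n" and den: "cf_den b n = cf_den ((!) w) n" if "n \<le> Suc k" for n
    using that b_w by (auto intro!: cf_cong)
  have "M > 0" by (simp add: M_def)
  have P: "2 * Suc k + 2 = 2 * M"
    by (simp add: M_def)
  have per: "b (m + (2 * Suc k + 2)) = b m" for m
  proof -
    have "(m + 2 * M) mod M = m mod M" "(m + 2 * M) div M = m div M + 2"
      using \<open>M > 0\<close> by simp_all
    then show ?thesis
      unfolding P b_def by simp
  qed
  have rep: "b (Suc (Suc k) + n) = b n" if "n < Suc k" for n
  proof -
    have "n < M"
      using that by (simp add: M_def)
    then show ?thesis
      using that unfolding M_def[symmetric] b_def by simp
  qed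
  have "b (Suc k) = c"
    by (simp add: b_def M_def)
  moreover have "Suc (2 * Suc k) = Suc k + 1 * M"
    by (simp add: M_def)
  then have "Suc (2 * Suc k) mod M = Suc k" "Suc (2 * Suc k) div M = 1"
    by (simp_all only: mod_mult_self1 div_mult_self1 M_def) simp_all
  then have "b (Suc (2 * Suc k)) = a - c"
    by (simp only: b_def) simp
  ultimately have sum: "b (Suc k) + b (Suc (2 * Suc k)) = 2 * cf_den b (Suc k) * cf_den b k"
    by (simp add: a_def den)
  have "cf_num b (Suc k) = 0"
    using w0 k by (simp add: num)
  note cf_periodic[OF this rep sum per]
  then have "cf_convergent b (m + (2 * Suc k + 2)) = cf_convergent b m" for m
    by (simp add: cf_convergent_def)
  \<comment> \<open>Convergent 0 is infinity and convergent \<open>Suc k\<close> is 0; a limit would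
    have to equal both.\<close>
  then have "\<not> cf_converges b"
    using limitin_riemann_sphere_periodic[of "cf_convergent b" _ "2 * Suc k + 2"]
      \<open>cf_num b (Suc k) = 0\<close> cf_convergent_eq_0_iff[of b "Suc k"]
    unfolding cf_converges_def
    by (metis cf_convergent_def cf_den.simps(1) option.distinct(1) zero_less_Suc add_2_eq_Suc')
  then have "b \<in> Ex_cf X"
    using X(1) by (simp add: exclusion_set_def)
  then obtain x where "x \<in> X" "substring_of_seq x (\<lambda>i. b (0 + i))"
    unfolding Ex_cf_def by blast
  then obtain r s where x: "x \<in> X" "r \<le> s" "x = map b [r..<Suc s]"
    unfolding substring_of_tail_iff by blast
  have block: "i mod M < Suc k" if "r \<le> i" "i \<le> s" for i
  proof (rule ccontr)
    assume "\<not> i mod M < Suc k"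
    then have "b i \<in> {c, a - c}"
      by (simp add: b_def)
    moreover have "b i \<in> set x"
      using that by (simp add: x(3) del: upt_Suc)
    ultimately show False
      using fresh x(1) by (auto simp: F_def)
  qed
  \<comment> \<open>\<open>q\<close> is the index at which the block containing \<open>r\<close>
    begins; its separator stands at \<open>q + Suc k\<close>.\<close>
  define q where "q = r div M * M"
  have q: "q \<le> r" "r \<le> q + Suc k"
    using div_mult_mod_eq[of r M] mod_less_divisor[OF \<open>M > 0\<close>, of r]
    unfolding q_def[symmetric] using M_def by linarith+
  have "Suc k < M"
    by (simp add: M_def)
  then have "(q + Suc k) mod M = Suc k"
    by (simp add: q_def del: add_Suc_right)
  then have s: "s < q + Suc k"
    using block[of "q + Suc k"] q by fastforce
  have b_q: "b i = w ! (i - q)" if "r \<le> i" "i \<le> s" for i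
  proof -
    have "i = q + (i - q)" "i - q < Suc k"
      using that q s by auto
    then have "i mod M = i - q"
      unfolding q_def using \<open>Suc k < M\<close> by (metis mod_less mod_mult_self3 less_trans)
    then show ?thesis
      using block[OF that] by (simp add: b_def)
  qed
  have "b (r + i) = w ! (r - q + i)" if "i < Suc s - r" for i
    using b_q[of "r + i"] q(1) that by simp
  then have "x = map ((!) w) [r - q..<Suc s - q]"
    unfolding x(3) using q s by (intro nth_equalityI) (simp_all del: upt_Suc)
  then have "sublist x w"
    using sublist_map_nth[of "Suc s - q" w "r - q"] s k by simp
  with x(1) show ?thesis
    by (rule that)
qed

section \<open>Inclusion of the exclusion classes\<close>

lemma Ex_cf_O_hat_subset:
  assumes "exclusion_set X" "finite X"
  shows "Ex_cf O_hat \<subseteq> Ex_cf X"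
proof
  fix b assume b: "b \<in> Ex_cf O_hat"
  show "b \<in> Ex_cf X"
    unfolding Ex_cf_def
  proof (intro CollectI allI)
    fix n
    obtain w where w: "w \<in> O_hat" "substring_of_seq w (\<lambda>i. b (n + i))"
      using b by (auto simp: Ex_cf_def)
    obtain r s where rs: "n \<le> r" "w = map b [r..<Suc s]"
      using w(2) by (auto simp: substring_of_tail_iff simp del: upt_Suc)
    obtain x where "x \<in> X" "sublist x w"
      using sublist_of_O_hat[OF assms w(1)] .
    moreover have "x \<noteq> []"
      using \<open>x \<in> X\<close> assms(1) by (auto simp: exclusion_set_def)
    ultimately show "\<exists>x\<in>X. substring_of_seq x (\<lambda>i. b (n + i))"
      using sublist_substring_of_tail rs by blast
  qed
qed

section \<open>Strictness of the inclusion\<close>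

text \<open>The vertices are infinity and then its integer neighbours n + 1, n, ..., 1, 0 in the
  Farey graph.\<close>

lemma fan_word_in_O_hat: "int (Suc n) # 1 # replicate n 2 \<in> O_hat"
proof -
  let ?w = "int (Suc n) # 1 # replicate n 2"
  have cf: "cf_num ((!) ?w) m = int (n + 2) - int m \<and> cf_den ((!) ?w) m = 1"
    if "1 \<le> m" "m \<le> n + 2" for m
    using that
  proof (induction m rule: induct_nat_012)
    case (ge2 m)
    show ?case
    proof (cases m)
      case (Suc m')
      then have "?w ! Suc m = 2"
        using ge2.prems by simp
      then show ?thesis
        using ge2 Suc by (simp del: nth_Cons_Suc)
    qed simp
  qed simp_all
  have "cf_cross ((!) ?w) i j \<noteq> 0" if "i < j" "j \<le> n + 2" for i j
    using that cf[of i] cf[of j] by (cases i) (auto simp: cf_cross_def simp del: cf_num.simps(2,3) cf_den.simps(2,3))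
  then show ?thesis
    unfolding O_hat_iff using cf[of "n + 2"] by (simp del: cf_num.simps)
qed

text \<open>An entry of modulus at least 2 gives growth by the triangle inequality. After an entry
  -2, the last two denominators have opposite signs, so at an entry 1 their moduli add. Entry 0 is
  left free since it does not enter the denominators.\<close>

lemma abs_cf_den_strict_mono:
  assumes "\<And>m. 1 \<le> m \<Longrightarrow> \<bar>b m\<bar> \<ge> 2 \<or> (b m = 1 \<and> 2 \<le> m \<and> b (m - 1) = - 2)"
  shows "strict_mono (\<lambda>m. \<bar>cf_den b m\<bar>)"
proof -
  have "\<bar>cf_den b m\<bar> < \<bar>cf_den b (Suc m)\<bar>" for m
  proof (induction m rule: induct_nat_012)
    case 1
    then show ?case
      using assms[of 1] by auto
  next
    case (ge2 m)
    have rec: "cf_den b (Suc (Suc (Suc m))) = b (Suc (Suc m)) * cf_den b (Suc (Suc m)) - cf_den b (Suc m)"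
      by (rule cf_den.simps(3))
    from assms[of "Suc (Suc m)"] consider "\<bar>b (Suc (Suc m))\<bar> \<ge> 2"
      | "b (Suc (Suc m)) = 1" "b (Suc m) = - 2"
      by auto
    then show ?case
    proof cases
      case 1
      then have "2 * \<bar>cf_den b (Suc (Suc m))\<bar> \<le> \<bar>b (Suc (Suc m)) * cf_den b (Suc (Suc m))\<bar>"
        unfolding abs_mult by (intro mult_right_mono) auto
      then show ?thesis
        using ge2(2) unfolding rec by linarith
    next
      case 2
      then have "cf_den b (Suc (Suc m)) = - 2 * cf_den b (Suc m) - cf_den b m"
        by simp
      then show ?thesis
        using ge2(1) unfolding rec 2(1) by linarith
    qed
  qed simp
  then show ?thesis
    by (rule strict_mono_Suc_iff[THEN iffD2, rule_format])
qed

lemma Ex_cf_O_hat_psubset: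
  assumes X: "exclusion_set X" "finite X"
  shows "Ex_cf O_hat \<subset> Ex_cf X"
proof -
  define F where "F = insert 0 (\<Union> (set ` X))"
  have "finite F"
    using X(2) by (simp add: F_def)
  \<comment> \<open>This puts \<open>n + 1\<close> above every entry of every word of
    \<open>X\<close>.\<close>
  define n where "n = nat (Max F)"
  have n: "int (Suc n) \<notin> F"
    using Max_ge[OF \<open>finite F\<close>, of "int (Suc n)"] by (auto simp: n_def)
  obtain x where x: "x \<in> X" "sublist x (int (Suc n) # 1 # replicate n 2)"
    using sublist_of_O_hat[OF X fan_word_in_O_hat] .
  have "x \<noteq> []"
    using X(1) x(1) by (auto simp: exclusion_set_def)
  have "int (Suc n) \<notin> set x"
    using n x(1) by (auto simp: F_def)
  then have x_sub: "sublist x (1 # replicate n 2)"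
    using x(2) \<open>x \<noteq> []\<close> by (cases x) (auto simp: sublist_Cons_right)
  define b :: "nat \<Rightarrow> int" where
    "b m = (if m mod (n + 2) = 0 then 1 else if m mod (n + 2) = n + 1 then - 2 else 2)" for m
  have "b \<in> Ex_cf X"
    unfolding Ex_cf_def
  proof (intro CollectI allI)
    fix N
    \<comment> \<open>A multiple of the period that is at least \<open>N\<close>, so a full block 1,
      2, ..., 2 starts there inside the tail.\<close>
    define M where "M = (n + 2) * N"
    have "b (M + i) = (if i = 0 then 1 else 2)" if "i < Suc n" for i
    proof -
      have "(M + i) mod (n + 2) = i"
        unfolding M_def mod_mult_self4 using that by simp
      then show ?thesis
        using that by (simp add: b_def)
    qed
    then have "map b [M..<M + Suc n] = 1 # replicate n 2"
      by (intro nth_equalityI) (auto simp: nth_Cons' simp del: upt_Suc)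
    then have "substring_of_seq x (\<lambda>i. b (N + i))"
      using x_sub \<open>x \<noteq> []\<close>
      by (intro sublist_substring_of_tail[of x b M "M + Suc n"]) (simp_all add: M_def)
    then show "\<exists>x\<in>X. substring_of_seq x (\<lambda>i. b (N + i))"
      using x(1) by blast
  qed
  moreover have "b \<notin> Ex_cf O_hat"
  proof
    \<comment> \<open>Away from index 0, each entry 1 opens a new period and so follows the -2 that
      closes the previous one.\<close>
    have step: "\<bar>b m\<bar> \<ge> 2 \<or> (b m = 1 \<and> 2 \<le> m \<and> b (m - 1) = - 2)" if "1 \<le> m" for m
    proof (cases "m mod (n + 2) = 0")
      case True
      then obtain t where "m = (n + 2) * t"
        by (auto elim: dvdE)
      with that obtain t' where "m = (n + 2) * Suc t'"
        by (cases t) auto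
      then have m: "m - 1 = n + 1 + (n + 2) * t'" "2 \<le> m"
        by auto
      then have "(m - 1) mod (n + 2) = n + 1"
        unfolding m(1) mod_mult_self2 by simp
      then show ?thesis
        using True m by (simp add: b_def)
    qed (simp add: b_def)
    assume "b \<in> Ex_cf O_hat"
    \<comment> \<open>In the tail from index 1 the word found starts at some \<open>r\<close> \<ge>
      1, so there is a convergent r - 1 for it to return to.\<close>
    then obtain w where "w \<in> O_hat" "substring_of_seq w (\<lambda>i. b (1 + i))"
      unfolding Ex_cf_def by blast
    then obtain r s where rs: "1 \<le> r" "map b [r..<Suc s] \<in> O_hat"
      unfolding substring_of_tail_iff by blast
    then obtain r' where "r = Suc r'"
      by (cases r) auto
    then have "r' < Suc s" "cf_cross b r' (Suc s) = 0"
      using rs(2) by (simp_all only: map_upt_in_O_hat_iff) auto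
    then show False
      using strict_monoD[OF abs_cf_den_strict_mono[OF step] \<open>r' < Suc s\<close>]
        cf_cross_eq_0_imp_abs_cf_den_eq[of b r' "Suc s"] by simp
  qed
  ultimately show ?thesis
    using Ex_cf_O_hat_subset[OF X] by blast
qed

theorem theoremB:
  shows "exclusion_set O_hat \<and>
    (\<forall>X. exclusion_set X \<and> finite X \<longrightarrow> Ex_cf O_hat \<subset> Ex_cf X)"
  using exclusion_set_O_hat Ex_cf_O_hat_psubset by blast

end
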